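(* The positive unit ball $B_{X_T}^+$ of the binary tree space $X_T$ is not an SCD set. In particular, $X_T$ is a space with an unconditional basis which fails to be SCD.
   Context: Binary tree space: $T=\{\emptyset\}\cup\bigcup_{n\in\mathbb{N}}\{0,1\}^n$ is the infinite binary tree of finite $0$-$1$ sequences, ordered by $s\preceq t$ iff $s$ is an initial segment of $t$. A chain is a non-empty (totally, hence well) ordered subset of $T$; $\mathcal{A}$ is the collection of all chains. $X_T$ is the real Banach space obtained by completing the space $c_{00}(T)$ of finitely supported real functions on $T$ for the norm $\|x\|=\sup_{A\in\mathcal{A}}\sum_{t\in A}|x(t)|$. The family $(e_t)_{t\in T}$ of unit vectors ($e_t$ takes value $1$ at $t$ and $0$ elsewhere) is a 1-unconditional basis of $X_T$, and elements of $X_T$ are identified with their coordinate functions $x=(x(t))_{t\in T}$. $B_{X_T}$ is the closed unit ball and $B_{X_T}^+=\{x\in B_{X_T}\colon x(t)\geq 0\ \forall t\in T\}$. SCD: Let $A$ be a bounded non-empty subset of a real Banach space $X$. A slice of $A$ is a set $S(A,f,\delta)=\{x\in A\colon f(x)>\sup f(A)-\delta\}$ with $f\in X^*$, $\delta>0$. A collection $\{A_i\}_{i\in I}$ of non-empty subsets of $A$ is determining for $A$ if $A\subseteq\overline{\mathrm{conv}}\{x_i\colon i\in I\}$ for every $(x_i)_{i\in I}\in\prod_{i\in I}A_i$. The set $A$ is slicely countably determined (an SCD set) if it admits a countable determining collection of slices. A separable Banach space $X$ is slicely countably determined (an SCD space) if every bounded non-empty subset of $X$ is an SCD set. *)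

theory Defs
  imports "HOL-Analysis.Analysis" "HOL-Library.Sublist"
begin

section \<open>Slicely countably determined sets and spaces\<close>

definition slice :: "'a::real_normed_vector set \<Rightarrow> ('a \<Rightarrow> real) \<Rightarrow> real \<Rightarrow> 'a set" where
  "slice A f \<delta> = {x \<in> A. f x > Sup (f ` A) - \<delta>}"

definition determining :: "'a::real_normed_vector set \<Rightarrow> 'i set \<Rightarrow> ('i \<Rightarrow> 'a set) \<Rightarrow> bool" where
  "determining A I S \<longleftrightarrow>
     (\<forall>i\<in>I. S i \<noteq> {} \<and> S i \<subseteq> A) \<and>
     (\<forall>x. (\<forall>i\<in>I. x i \<in> S i) \<longrightarrow> A \<subseteq> closure (convex hull (x ` I)))"

text \<open>Meaningful for bounded non-empty sets only. A countable collection is one indexed by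
  some set of natural numbers.\<close>

definition SCD_set :: "'a::banach set \<Rightarrow> bool" where
  "SCD_set A \<longleftrightarrow>
     (\<exists>(I :: nat set) S.
        (\<forall>i\<in>I. \<exists>f \<delta>. bounded_linear f \<and> \<delta> > 0 \<and> S i = slice A f \<delta>) \<and>
        determining A I S)"

text \<open>For normed spaces, the class \<open>second_countable_topology\<close> expresses separability.\<close>

definition SCD_space :: "'a::{banach, second_countable_topology} itself \<Rightarrow> bool" where
  "SCD_space _ \<longleftrightarrow> (\<forall>A :: 'a set. bounded A \<and> A \<noteq> {} \<longrightarrow> SCD_set A)"

text \<open>Since the index set carries no order, \<open>has_sum\<close> is unconditional convergence.\<close>

definition unconditional_basis :: "('i::countable \<Rightarrow> 'a::banach) \<Rightarrow> bool" where
  "unconditional_basis e \<longleftrightarrow>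
     (\<forall>x. \<exists>!a :: 'i \<Rightarrow> real. ((\<lambda>i. a i *\<^sub>R e i) has_sum x) UNIV)"


section \<open>The binary tree space\<close>

text \<open>The nodes of the binary tree are the finite 0-1 sequences, ordered by \<^const>\<open>prefix\<close>.\<close>

type_synonym node = "bool list"

definition tree_chains :: "node set set" where
  "tree_chains = {A. A \<noteq> {} \<and> Complete_Partial_Order.chain prefix A}"

definition chain_norm :: "(node \<Rightarrow> real) \<Rightarrow> ennreal" where
  "chain_norm x = (SUP A\<in>tree_chains. \<Sum>\<^sub>\<infinity>t\<in>A. ennreal \<bar>x t\<bar>)"

lemma sum_le_chain_norm:
  assumes "finite F" "F \<in> tree_chains"
  shows "(\<Sum>t\<in>F. ennreal \<bar>x t\<bar>) \<le> chain_norm x"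
  unfolding chain_norm_def using assms by (intro SUP_upper2[of F]) simp_all

lemma chain_norm_le:
  assumes "\<And>F. finite F \<Longrightarrow> F \<in> tree_chains \<Longrightarrow> (\<Sum>t\<in>F. ennreal \<bar>x t\<bar>) \<le> c"
  shows "chain_norm x \<le> c"
  unfolding chain_norm_def
proof (rule SUP_least)
  fix A assume A: "A \<in> tree_chains"
  show "(\<Sum>\<^sub>\<infinity>t\<in>A. ennreal \<bar>x t\<bar>) \<le> c"
  proof (rule infsum_le_finite_sums)
    fix F assume F: "finite F" "F \<subseteq> A"
    show "(\<Sum>t\<in>F. ennreal \<bar>x t\<bar>) \<le> c"
    proof (cases "F = {}")
      case False
      then have "F \<in> tree_chains"
        using A F by (auto simp: tree_chains_def intro: chain_subset)
      then show ?thesis using assms F by simp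
    qed simp
  qed (simp add: nonneg_summable_on_complete)
qed

lemma singleton_tree_chain: "{t} \<in> tree_chains"
  by (simp add: tree_chains_def chain_def)

lemma abs_le_chain_norm: "ennreal \<bar>x t\<bar> \<le> chain_norm x"
  using sum_le_chain_norm[of "{t}" x] singleton_tree_chain by simp

lemma chain_norm_zero [simp]: "chain_norm (\<lambda>_. 0) = 0"
  by (rule antisym[OF chain_norm_le]) simp_all

lemma chain_norm_add: "chain_norm (\<lambda>t. x t + y t) \<le> chain_norm x + chain_norm y"
proof (rule chain_norm_le)
  fix F assume F: "finite F" "F \<in> tree_chains"
  have "(\<Sum>t\<in>F. ennreal \<bar>x t + y t\<bar>) \<le> (\<Sum>t\<in>F. ennreal \<bar>x t\<bar> + ennreal \<bar>y t\<bar>)"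
    by (intro sum_mono) (simp flip: ennreal_plus)
  also have "\<dots> \<le> chain_norm x + chain_norm y"
    unfolding sum.distrib using F by (intro add_mono sum_le_chain_norm)
  finally show "(\<Sum>t\<in>F. ennreal \<bar>x t + y t\<bar>) \<le> chain_norm x + chain_norm y" .
qed

lemma chain_norm_scale_le: "chain_norm (\<lambda>t. c * x t) \<le> ennreal \<bar>c\<bar> * chain_norm x"
proof (rule chain_norm_le)
  fix F assume F: "finite F" "F \<in> tree_chains"
  have "(\<Sum>t\<in>F. ennreal \<bar>c * x t\<bar>) = ennreal \<bar>c\<bar> * (\<Sum>t\<in>F. ennreal \<bar>x t\<bar>)"
    by (simp add: abs_mult ennreal_mult sum_distrib_left del: sum_ennreal)
  also have "\<dots> \<le> ennreal \<bar>c\<bar> * chain_norm x"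
    using F by (intro mult_left_mono sum_le_chain_norm) simp_all
  finally show "(\<Sum>t\<in>F. ennreal \<bar>c * x t\<bar>) \<le> ennreal \<bar>c\<bar> * chain_norm x" .
qed

lemma chain_norm_finite_support:
  assumes "finite {t. x t \<noteq> 0}"
  shows "chain_norm x < \<infinity>"
proof -
  have "chain_norm x \<le> (\<Sum>t | x t \<noteq> 0. ennreal \<bar>x t\<bar>)"
  proof (rule chain_norm_le)
    fix F :: "node set" assume F: "finite F"
    have "(\<Sum>t\<in>F. ennreal \<bar>x t\<bar>) = (\<Sum>t\<in>F \<inter> {t. x t \<noteq> 0}. ennreal \<bar>x t\<bar>)"
      using F by (intro sum.mono_neutral_right) auto
    also have "\<dots> \<le> (\<Sum>t | x t \<noteq> 0. ennreal \<bar>x t\<bar>)"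
      using assms by (intro sum_mono2) auto
    finally show "(\<Sum>t\<in>F. ennreal \<bar>x t\<bar>) \<le> (\<Sum>t | x t \<noteq> 0. ennreal \<bar>x t\<bar>)" .
  qed
  also have "\<dots> < \<infinity>" by (simp add: sum_ennreal)
  finally show ?thesis .
qed

text \<open>Elements of the completion of the finitely supported functions are identified with their
  coordinate functions: the completion is the closure of the finitely supported functions
  with respect to \<^const>\<open>chain_norm\<close>. The lemmas \<open>norm_tree_space_finite_support\<close>,
  \<open>closure_finite_support\<close> and the \<open>banach\<close> instance below confirm this.\<close>

definition in_tree_space :: "(node \<Rightarrow> real) \<Rightarrow> bool" where
  "in_tree_space x \<longleftrightarrow>
     (\<forall>\<epsilon>>0. \<exists>y. finite {t. y t \<noteq> 0} \<and> chain_norm (\<lambda>t. x t - y t) < ennreal \<epsilon>)"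

lemma in_tree_space_finite_support:
  "finite {t. x t \<noteq> 0} \<Longrightarrow> in_tree_space x"
  unfolding in_tree_space_def by (intro allI impI exI[of _ x]) simp

lemma in_tree_space_norm_finite:
  assumes "in_tree_space x"
  shows "chain_norm x < \<infinity>"
proof -
  obtain y where y: "finite {t. y t \<noteq> 0}" "chain_norm (\<lambda>t. x t - y t) < ennreal 1"
    using assms unfolding in_tree_space_def by (meson zero_less_one)
  have "chain_norm x \<le> chain_norm (\<lambda>t. x t - y t) + chain_norm y"
    using chain_norm_add[of "\<lambda>t. x t - y t" y] by simp
  also have "\<dots> < \<infinity>"
    using y chain_norm_finite_support[OF y(1)]
    by (auto intro: less_trans simp: ennreal_add_less_top)
  finally show ?thesis .
qed

lemma in_tree_space_add:
  assumes "in_tree_space x" "in_tree_space y"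
  shows "in_tree_space (\<lambda>t. x t + y t)"
  unfolding in_tree_space_def
proof (intro allI impI)
  fix \<epsilon> :: real assume "\<epsilon> > 0"
  then obtain u v where u: "finite {t. u t \<noteq> 0}" "chain_norm (\<lambda>t. x t - u t) < ennreal (\<epsilon>/2)"
    and v: "finite {t. v t \<noteq> 0}" "chain_norm (\<lambda>t. y t - v t) < ennreal (\<epsilon>/2)"
    using assms unfolding in_tree_space_def by (meson half_gt_zero)
  have "finite {t. u t + v t \<noteq> 0}"
    by (rule finite_subset[of _ "{t. u t \<noteq> 0} \<union> {t. v t \<noteq> 0}"]) (use u v in auto)
  moreover have "chain_norm (\<lambda>t. x t + y t - (u t + v t)) < ennreal \<epsilon>"
  proof -
    have "chain_norm (\<lambda>t. x t + y t - (u t + v t))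
        \<le> chain_norm (\<lambda>t. x t - u t) + chain_norm (\<lambda>t. y t - v t)"
      using chain_norm_add[of "\<lambda>t. x t - u t" "\<lambda>t. y t - v t"] by (simp add: algebra_simps)
    also have "\<dots> < ennreal (\<epsilon>/2) + ennreal (\<epsilon>/2)"
      using u v by (intro add_strict_mono) auto
    also have "\<dots> = ennreal \<epsilon>"
      using \<open>\<epsilon> > 0\<close> by (simp flip: ennreal_plus)
    finally show ?thesis .
  qed
  ultimately show "\<exists>w. finite {t. w t \<noteq> 0} \<and> chain_norm (\<lambda>t. x t + y t - w t) < ennreal \<epsilon>"
    by (intro exI[of _ "\<lambda>t. u t + v t"] conjI)
qed

lemma in_tree_space_scale:
  assumes "in_tree_space x"
  shows "in_tree_space (\<lambda>t. c * x t)"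
  unfolding in_tree_space_def
proof (intro allI impI)
  fix \<epsilon> :: real assume "\<epsilon> > 0"
  then have "\<epsilon> / (\<bar>c\<bar> + 1) > 0" by (simp add: divide_pos_pos)
  then obtain u where u: "finite {t. u t \<noteq> 0}"
      "chain_norm (\<lambda>t. x t - u t) < ennreal (\<epsilon> / (\<bar>c\<bar> + 1))"
    using assms unfolding in_tree_space_def by meson
  have "finite {t. c * u t \<noteq> 0}"
    by (rule finite_subset[OF _ u(1)]) auto
  moreover have "chain_norm (\<lambda>t. c * x t - c * u t) < ennreal \<epsilon>"
  proof -
    have "chain_norm (\<lambda>t. c * x t - c * u t) \<le> ennreal \<bar>c\<bar> * chain_norm (\<lambda>t. x t - u t)"
      using chain_norm_scale_le[of c "\<lambda>t. x t - u t"] by (simp add: algebra_simps)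
    also have "\<dots> \<le> ennreal \<bar>c\<bar> * ennreal (\<epsilon> / (\<bar>c\<bar> + 1))"
      using u by (intro mult_left_mono) auto
    also have "\<dots> = ennreal (\<bar>c\<bar> * (\<epsilon> / (\<bar>c\<bar> + 1)))"
      using \<open>\<epsilon> > 0\<close> by (intro ennreal_mult[symmetric]) simp_all
    also have "\<dots> < ennreal \<epsilon>"
      using \<open>\<epsilon> > 0\<close> by (intro ennreal_lessI) (auto simp: field_simps)
    finally show ?thesis .
  qed
  ultimately show "\<exists>w. finite {t. w t \<noteq> 0} \<and> chain_norm (\<lambda>t. c * x t - w t) < ennreal \<epsilon>"
    by (intro exI[of _ "\<lambda>t. c * u t"] conjI)
qed

typedef tree_space = "{x. in_tree_space x}"
  morphisms coord Abs_tree_space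
proof
  show "(\<lambda>_. 0) \<in> {x. in_tree_space x}"
    by (simp add: in_tree_space_finite_support)
qed

setup_lifting type_definition_tree_space

lemma in_tree_space_coord [simp]: "in_tree_space (coord x)"
  using coord by simp

instantiation tree_space :: real_vector
begin

lift_definition zero_tree_space :: tree_space is "\<lambda>_. 0"
  by (simp add: in_tree_space_finite_support)

lift_definition plus_tree_space :: "tree_space \<Rightarrow> tree_space \<Rightarrow> tree_space" is "\<lambda>x y t. x t + y t"
  by (rule in_tree_space_add)

lift_definition uminus_tree_space :: "tree_space \<Rightarrow> tree_space" is "\<lambda>x t. - x t"
  using in_tree_space_scale[where c = "-1"] by simp

lift_definition minus_tree_space :: "tree_space \<Rightarrow> tree_space \<Rightarrow> tree_space" is "\<lambda>x y t. x t - y t"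
  subgoal for x y
    using in_tree_space_add[of x "\<lambda>t. - y t"] in_tree_space_scale[of y "-1"] by simp
  done

lift_definition scaleR_tree_space :: "real \<Rightarrow> tree_space \<Rightarrow> tree_space" is "\<lambda>c x t. c * x t"
  by (rule in_tree_space_scale)

instance
  by standard (transfer; simp add: algebra_simps fun_eq_iff)+

end

lemma coord_simps [simp]:
  "coord 0 t = 0"
  "coord (x + y) t = coord x t + coord y t"
  "coord (x - y) t = coord x t - coord y t"
  "coord (- x) t = - coord x t"
  "coord (c *\<^sub>R x) t = c * coord x t"
  by (transfer; simp)+

lemma coord_sum [simp]: "coord (\<Sum>i\<in>I. f i) t = (\<Sum>i\<in>I. coord (f i) t)"
  by (induction I rule: infinite_finite_induct) auto

instantiation tree_space :: real_normed_vector
begin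

definition norm_tree_space :: "tree_space \<Rightarrow> real" where
  "norm_tree_space x = enn2real (chain_norm (coord x))"

definition sgn_tree_space :: "tree_space \<Rightarrow> tree_space" where
  "sgn_tree_space x = x /\<^sub>R norm x"

definition dist_tree_space :: "tree_space \<Rightarrow> tree_space \<Rightarrow> real" where
  "dist_tree_space x y = norm (x - y)"

definition uniformity_tree_space :: "(tree_space \<times> tree_space) filter" where
  "uniformity_tree_space = (INF e\<in>{0<..}. principal {(x, y). dist x y < e})"

definition open_tree_space :: "tree_space set \<Rightarrow> bool" where
  "open_tree_space U \<longleftrightarrow> (\<forall>x\<in>U. eventually (\<lambda>(x', y). x' = x \<longrightarrow> y \<in> U) uniformity)"

lemma ennreal_norm_tree_space: "ennreal (norm (x :: tree_space)) = chain_norm (coord x)"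
  using in_tree_space_norm_finite[of "coord x"] by (simp add: norm_tree_space_def less_top)

lemma norm_tree_space_le_iff:
  "c \<ge> 0 \<Longrightarrow> norm (x :: tree_space) \<le> c \<longleftrightarrow> chain_norm (coord x) \<le> ennreal c"
  by (simp flip: ennreal_norm_tree_space)

lemma norm_tree_space_scale_le: "norm (c *\<^sub>R (x :: tree_space)) \<le> \<bar>c\<bar> * norm x"
proof -
  have "0 \<le> norm x" by (simp add: norm_tree_space_def)
  moreover have "coord (c *\<^sub>R x) = (\<lambda>t. c * coord x t)" by auto
  ultimately show ?thesis
    using chain_norm_scale_le[of c "coord x"]
    by (simp add: norm_tree_space_le_iff ennreal_mult flip: ennreal_norm_tree_space[of x])
qed

instance
proof
  fix x y :: tree_space and c :: real
  have nonneg: "0 \<le> norm z" for z :: tree_space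
    by (simp add: norm_tree_space_def)
  show "norm x = 0 \<longleftrightarrow> x = 0"
  proof
    assume "norm x = 0"
    then have "chain_norm (coord x) = 0"
      by (simp flip: ennreal_norm_tree_space)
    then have "coord x t = 0" for t
      using abs_le_chain_norm[of "coord x" t] by simp
    then show "x = 0" by (simp flip: coord_inject add: fun_eq_iff)
  next
    assume "x = 0"
    then have "coord x = (\<lambda>_. 0)" by auto
    then show "norm x = 0" by (simp add: norm_tree_space_def)
  qed
  have "coord (x + y) = (\<lambda>t. coord x t + coord y t)" by auto
  then show "norm (x + y) \<le> norm x + norm y"
    using chain_norm_add[of "coord x" "coord y"] nonneg
    by (simp add: norm_tree_space_le_iff flip: ennreal_norm_tree_space[of x] ennreal_norm_tree_space[of y])
  show "norm (c *\<^sub>R x) = \<bar>c\<bar> * norm x"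
  proof (cases "c = 0")
    case True
    have "coord 0 = (\<lambda>_. 0)" by auto
    then show ?thesis using True by (simp add: norm_tree_space_def)
  next
    case False
    have "norm x = norm (inverse c *\<^sub>R (c *\<^sub>R x))" using False by simp
    also have "\<dots> \<le> \<bar>inverse c\<bar> * norm (c *\<^sub>R x)" by (rule norm_tree_space_scale_le)
    finally have "\<bar>c\<bar> * norm x \<le> norm (c *\<^sub>R x)"
      using False by (simp add: field_simps)
    then show ?thesis using norm_tree_space_scale_le[of c x] by simp
  qed
qed (simp_all add: sgn_tree_space_def dist_tree_space_def uniformity_tree_space_def open_tree_space_def)

end

lemma abs_coord_le_norm: "\<bar>coord x t\<bar> \<le> norm x"
  using abs_le_chain_norm[of "coord x" t] by (simp flip: ennreal_norm_tree_space)

lemma sum_abs_coord_le_norm: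
  assumes "finite F" "F \<in> tree_chains"
  shows "(\<Sum>t\<in>F. \<bar>coord x t\<bar>) \<le> norm x"
  using sum_le_chain_norm[OF assms, of "coord x"]
  by (simp add: sum_ennreal flip: ennreal_norm_tree_space)

lemma norm_tree_space_finite_support:
  assumes fin: "finite {t. coord x t \<noteq> 0}"
  shows "norm x = (SUP A\<in>tree_chains. \<Sum>t | t \<in> A \<and> coord x t \<noteq> 0. \<bar>coord x t\<bar>)"
    (is "_ = (SUP A\<in>_. ?s A)")
proof (rule antisym)
  have le: "?s A \<le> norm x" if A: "A \<in> tree_chains" for A
  proof (cases "{t. t \<in> A \<and> coord x t \<noteq> 0} = {}")
    case False
    then have "{t. t \<in> A \<and> coord x t \<noteq> 0} \<in> tree_chains"
      using A by (auto simp: tree_chains_def intro: chain_subset)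
    then show ?thesis using fin by (intro sum_abs_coord_le_norm) auto
  next
    case True
    then show ?thesis by (simp only: sum.empty norm_ge_zero)
  qed
  then show "(SUP A\<in>tree_chains. ?s A) \<le> norm x"
    using singleton_tree_chain by (intro cSUP_least) auto
  have bdd: "bdd_above (?s ` tree_chains)"
    using le by (auto intro!: bdd_aboveI)
  have nonneg: "0 \<le> (SUP A\<in>tree_chains. ?s A)"
    by (rule cSUP_upper2[OF bdd singleton_tree_chain[of "[]"]]) (simp add: sum_nonneg)
  show "norm x \<le> (SUP A\<in>tree_chains. ?s A)"
    unfolding norm_tree_space_le_iff[OF nonneg]
  proof (rule chain_norm_le)
    fix F assume F: "finite F" "F \<in> tree_chains"
    have "(\<Sum>t\<in>F. \<bar>coord x t\<bar>) = ?s F"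
      using F by (intro sum.mono_neutral_right) auto
    also have "\<dots> \<le> (SUP A\<in>tree_chains. ?s A)"
      using F bdd by (intro cSUP_upper)
    finally show "(\<Sum>t\<in>F. ennreal \<bar>coord x t\<bar>) \<le> ennreal (SUP A\<in>tree_chains. ?s A)"
      by (simp add: sum_ennreal ennreal_leI)
  qed
qed

lemma finite_support_approx:
  assumes "\<epsilon> > 0"
  obtains y where "finite {t. coord y t \<noteq> 0}" "norm (x - y) < \<epsilon>"
proof -
  obtain u where u: "finite {t. u t \<noteq> 0}" "chain_norm (\<lambda>t. coord x t - u t) < ennreal \<epsilon>"
    using assms in_tree_space_coord[of x] unfolding in_tree_space_def by meson
  define y where "y = Abs_tree_space u"
  have y: "coord y = u"
    using u by (simp add: y_def Abs_tree_space_inverse in_tree_space_finite_support)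
  have "coord (x - y) = (\<lambda>t. coord x t - u t)" using y by auto
  with u have "ennreal (norm (x - y)) < ennreal \<epsilon>"
    by (simp add: ennreal_norm_tree_space)
  then have "norm (x - y) < \<epsilon>" using assms by (simp add: ennreal_less_iff)
  with u y show ?thesis using that[of y] by simp
qed

lemma closure_finite_support: "closure {x. finite {t. coord x t \<noteq> 0}} = UNIV"
proof (intro equalityI subset_UNIV subsetI)
  fix x :: tree_space
  show "x \<in> closure {x. finite {t. coord x t \<noteq> 0}}"
    unfolding closure_approachable dist_norm
    by (metis finite_support_approx mem_Collect_eq norm_minus_commute)
qed

instance tree_space :: banach
proof
  fix X :: "nat \<Rightarrow> tree_space" assume X: "Cauchy X"
  have "Cauchy (\<lambda>n. coord (X n) t)" for t
  proof (rule CauchyI)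
    fix e :: real assume "e > 0"
    then obtain M where "\<forall>m\<ge>M. \<forall>n\<ge>M. norm (X m - X n) < e"
      using CauchyD[OF X] by blast
    then show "\<exists>M. \<forall>m\<ge>M. \<forall>n\<ge>M. norm (coord (X m) t - coord (X n) t) < e"
      using abs_coord_le_norm[of "X _ - X _" t] by (metis coord_simps(3) le_less_trans real_norm_def)
  qed
  then have "\<forall>t. \<exists>l. (\<lambda>n. coord (X n) t) \<longlonglongrightarrow> l"
    by (simp add: Cauchy_convergent_iff convergent_def)
  then obtain x where x: "\<And>t. (\<lambda>n. coord (X n) t) \<longlonglongrightarrow> x t" by metis
  have close: "chain_norm (\<lambda>t. coord (X n) t - x t) \<le> ennreal e"
    if M: "\<And>m n. m \<ge> M \<Longrightarrow> n \<ge> M \<Longrightarrow> norm (X m - X n) < e" and n: "n \<ge> M" and e: "e > 0" for M n e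
  proof (rule chain_norm_le)
    fix F assume F: "finite F" "F \<in> tree_chains"
    have "(\<lambda>m. \<Sum>t\<in>F. \<bar>coord (X n - X m) t\<bar>) \<longlonglongrightarrow> (\<Sum>t\<in>F. \<bar>coord (X n) t - x t\<bar>)"
      unfolding coord_simps by (intro tendsto_intros x)
    moreover have "(\<Sum>t\<in>F. \<bar>coord (X n - X m) t\<bar>) \<le> e" if "m \<ge> M" for m
      using sum_abs_coord_le_norm[OF F, of "X n - X m"] M[OF n that] by linarith
    ultimately have "(\<Sum>t\<in>F. \<bar>coord (X n) t - x t\<bar>) \<le> e"
      by (intro LIMSEQ_le_const2) auto
    then show "(\<Sum>t\<in>F. ennreal \<bar>coord (X n) t - x t\<bar>) \<le> ennreal e"
      by (simp add: sum_ennreal ennreal_leI)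
  qed
  have "in_tree_space x"
    unfolding in_tree_space_def
  proof (intro allI impI)
    fix e :: real assume e: "e > 0"
    then obtain M where M: "\<forall>m\<ge>M. \<forall>n\<ge>M. norm (X m - X n) < e/2"
      using CauchyD[OF X, of "e/2"] by auto
    then have 1: "chain_norm (\<lambda>t. coord (X M) t - x t) \<le> ennreal (e/2)"
      using e by (intro close[of M]) auto
    have neg: "(\<lambda>t. x t - coord (X M) t) = (\<lambda>t. (-1) * (coord (X M) t - x t))" by auto
    have 1: "chain_norm (\<lambda>t. x t - coord (X M) t) \<le> ennreal (e/2)"
      unfolding neg using chain_norm_scale_le[of "-1" "\<lambda>t. coord (X M) t - x t"] 1 by auto
    obtain y where y: "finite {t. y t \<noteq> 0}" "chain_norm (\<lambda>t. coord (X M) t - y t) < ennreal (e/2)"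
      using e in_tree_space_coord[of "X M"] unfolding in_tree_space_def by (meson half_gt_zero)
    have "chain_norm (\<lambda>t. x t - y t)
        \<le> chain_norm (\<lambda>t. x t - coord (X M) t) + chain_norm (\<lambda>t. coord (X M) t - y t)"
      using chain_norm_add[of "\<lambda>t. x t - coord (X M) t" "\<lambda>t. coord (X M) t - y t"] by simp
    also have "\<dots> \<le> ennreal (e/2) + chain_norm (\<lambda>t. coord (X M) t - y t)"
      using 1 by (intro add_right_mono)
    also have "\<dots> < ennreal (e/2) + ennreal (e/2)"
      using y(2) by (simp add: ennreal_add_left_cancel_less)
    also have "\<dots> = ennreal e"
      using e by (simp flip: ennreal_plus)
    finally show "\<exists>y. finite {t. y t \<noteq> 0} \<and> chain_norm (\<lambda>t. x t - y t) < ennreal e"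
      using y(1) by blast
  qed
  then have cx: "coord (Abs_tree_space x) = x" by (simp add: Abs_tree_space_inverse)
  have "X \<longlonglongrightarrow> Abs_tree_space x"
  proof (rule LIMSEQ_I)
    fix e :: real assume e: "e > 0"
    then obtain M where M: "\<forall>m\<ge>M. \<forall>n\<ge>M. norm (X m - X n) < e/2"
      using CauchyD[OF X, of "e/2"] by auto
    have "norm (X n - Abs_tree_space x) < e" if "n \<ge> M" for n
    proof -
      have "coord (X n - Abs_tree_space x) = (\<lambda>t. coord (X n) t - x t)" using cx by auto
      then have "norm (X n - Abs_tree_space x) \<le> e/2"
        using e close[of M "e/2" n] M that norm_tree_space_le_iff[of "e/2" "X n - Abs_tree_space x"]
        by auto
      then show ?thesis using e by linarith
    qed
    then show "\<exists>no. \<forall>n\<ge>no. norm (X n - Abs_tree_space x) < e" by blast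
  qed
  then show "convergent X" by (auto simp: convergent_def)
qed

lift_definition tree_unit :: "node \<Rightarrow> tree_space" is "\<lambda>t s. if s = t then 1 else 0"
  by (rule in_tree_space_finite_support) simp

lemma coord_tree_unit [simp]: "coord (tree_unit t) s = (if s = t then 1 else 0)"
  by transfer simp

lemma norm_tree_unit_le: "norm (tree_unit t) \<le> 1"
proof -
  have "chain_norm (coord (tree_unit t)) \<le> ennreal 1"
  proof (rule chain_norm_le)
    fix F :: "node set" assume F: "finite F"
    have "(\<Sum>s\<in>F. \<bar>coord (tree_unit t) s\<bar>) \<le> 1"
      using F by (simp add: if_distrib[of abs] cong: if_cong)
    then show "(\<Sum>s\<in>F. ennreal \<bar>coord (tree_unit t) s\<bar>) \<le> ennreal 1"
      by (simp only: sum_ennreal abs_ge_zero ennreal_leI)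
  qed
  then show ?thesis by (simp add: norm_tree_space_le_iff)
qed

lemma finite_support_eq_sum:
  assumes "finite {t. coord y t \<noteq> 0}"
  shows "y = (\<Sum>t | coord y t \<noteq> 0. coord y t *\<^sub>R tree_unit t)"
  using assms by (simp flip: coord_inject add: fun_eq_iff if_distrib cong: if_cong)

definition rational_combination :: "(node \<times> rat) list \<Rightarrow> tree_space" where
  "rational_combination l = (\<Sum>(t, q)\<leftarrow>l. of_rat q *\<^sub>R tree_unit t)"

lemma rational_combination_dense:
  assumes "\<epsilon> > 0"
  shows "\<exists>l. norm (x - rational_combination l) < \<epsilon>"
proof -
  obtain y where y: "finite {t. coord y t \<noteq> 0}" "norm (x - y) < \<epsilon>/2"
    using finite_support_approx[of "\<epsilon>/2" x] assms by auto
  define F where "F = {t. coord y t \<noteq> 0}"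
  define \<delta> where "\<delta> = \<epsilon> / (2 * (real (card F) + 1))"
  have "\<delta> > 0" using assms by (simp add: \<delta>_def)
  have "\<exists>q. \<bar>coord y t - of_rat q\<bar> < \<delta>" for t
  proof -
    obtain r where "r \<in> \<rat>" "coord y t < r" "r < coord y t + \<delta>"
      using Rats_dense_in_real[of "coord y t" "coord y t + \<delta>"] \<open>\<delta> > 0\<close> by auto
    moreover from this obtain q where "r = of_rat q" by (auto elim: Rats_cases)
    ultimately have "\<bar>coord y t - of_rat q\<bar> < \<delta>" by linarith
    then show ?thesis by blast
  qed
  then obtain q where q: "\<And>t. \<bar>coord y t - of_rat (q t)\<bar> < \<delta>" by metis
  obtain ts where ts: "set ts = F" "distinct ts"
    using finite_distinct_list y(1) F_def by blast
  define l where "l = map (\<lambda>t. (t, q t)) ts"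
  have l: "rational_combination l = (\<Sum>t\<in>F. of_rat (q t) *\<^sub>R tree_unit t)"
    using ts by (simp add: rational_combination_def l_def comp_def sum_list_distinct_conv_sum_set)
  have "norm (y - rational_combination l) = norm (\<Sum>t\<in>F. (coord y t - of_rat (q t)) *\<^sub>R tree_unit t)"
    using finite_support_eq_sum[OF y(1)] unfolding l F_def
    by (simp add: scaleR_diff_left sum_subtractf)
  also have "\<dots> \<le> (\<Sum>t\<in>F. \<delta>)"
  proof (rule order_trans[OF norm_sum], rule sum_mono)
    fix t
    show "norm ((coord y t - of_rat (q t)) *\<^sub>R tree_unit t) \<le> \<delta>"
      using mult_mono[OF less_imp_le[OF q[of t]] norm_tree_unit_le[of t]] \<open>\<delta> > 0\<close> by simp
  qed
  also have "\<dots> \<le> \<epsilon>/2"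
    using assms by (simp add: \<delta>_def field_simps)
  finally have "norm (y - rational_combination l) \<le> \<epsilon>/2" .
  then have "norm (x - rational_combination l) < \<epsilon>"
    using norm_triangle_ineq[of "x - y" "y - rational_combination l"] y(2) by simp
  then show ?thesis by blast
qed

instance tree_space :: second_countable_topology
proof
  define B where "B = (\<lambda>(l, n). ball (rational_combination l) (inverse (real (Suc n)))) ` UNIV"
  have "topological_basis B"
  proof (rule topological_basisI)
    fix U and x :: tree_space assume "open U" "x \<in> U"
    then obtain e where e: "e > 0" "ball x e \<subseteq> U" by (meson open_contains_ball)
    then obtain n where n: "inverse (real (Suc n)) < e/2"
      using reals_Archimedean[of "e/2"] by auto
    obtain l where l: "norm (x - rational_combination l) < inverse (real (Suc n))"
      using rational_combination_dense[of "inverse (real (Suc n))" x] by auto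
    let ?b = "ball (rational_combination l) (inverse (real (Suc n)))"
    have "x \<in> ?b" using l by (simp add: dist_norm norm_minus_commute)
    moreover have "?b \<subseteq> ball x e"
    proof
      fix z assume z: "z \<in> ?b"
      have "dist x z \<le> dist x (rational_combination l) + dist (rational_combination l) z"
        by (rule dist_triangle)
      then show "z \<in> ball x e" using z l n by (simp add: dist_norm)
    qed
    moreover have "?b \<in> B" unfolding B_def by (rule image_eqI[of _ _ "(l, n)"]) auto
    ultimately show "\<exists>B'\<in>B. x \<in> B' \<and> B' \<subseteq> U" using e by blast
  qed (auto simp: B_def)
  moreover have "countable B" by (simp add: B_def)
  ultimately show "\<exists>B :: tree_space set set. countable B \<and> open = generate_topology B"
    using topological_basis_imp_subbasis by blast
qed

definition tree_pos_ball :: "tree_space set" where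
  "tree_pos_ball = {x \<in> cball 0 1. \<forall>t. coord x t \<ge> 0}"

lemma tree_pos_ball_nonempty: "tree_pos_ball \<noteq> {}"
  by (auto simp: tree_pos_ball_def intro: exI[of _ 0])

lemma bounded_tree_pos_ball: "bounded tree_pos_ball"
  by (rule bounded_subset[OF bounded_cball[of 0 1]]) (auto simp: tree_pos_ball_def)

end

theory Submission
  imports Defs
begin

text \<open>
  The origin lies in the positive ball \<open>A\<close>, and the proof shows that no countable family of
  slices of \<open>A\<close> can force it into the closed convex hull. Given slices \<open>S\<^sub>0, S\<^sub>1, \<dots>\<close> one descends
  along a single branch of the tree, choosing \<open>x\<^sub>n \<in> S\<^sub>n\<close> such that the coordinates of \<open>x\<^sub>n\<close> along
  that branch sum to 1. The coordinates are nonnegative, so a convex combination of the \<open>x\<^sub>n\<close>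
  again has mass 1 on the branch and hence norm at least 1, which keeps the closed convex hull away
  from the origin.

  The descent is possible because a slice cannot control what happens deep in the tree
  (\<open>slice_meets_full_mass\<close>). Truncation puts a finitely supported point \<open>y\<close> into the slice.
  Below any node there is an infinite antichain avoiding the support of \<open>y\<close>; unit vectors on
  an antichain span an isometric copy of \<open>c\<^sub>0\<close>, so a bounded functional must be almost
  nonnegative at some of them. At such a node \<open>t\<close> one adds to \<open>y\<close> whatever mass is missing on the
  path from the root to \<open>t\<close>: this keeps the norm at most 1, because \<open>y\<close> vanishes below \<open>t\<close>, and
  hardly lowers the functional.

  The unit vectors form an unconditional basis because the norm depends monotonically on the absolute
  values of the coordinates: if \<open>u\<close> is finitely supported and close to \<open>x\<close>, then every truncation
  of \<open>x\<close> to a finite set containing the support of \<open>u\<close> is at least as close to \<open>x\<close>.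
\<close>

section \<open>Truncations and the unconditional basis\<close>

lemma norm_tree_space_leI:
  assumes "0 \<le> c" "\<And>F. finite F \<Longrightarrow> F \<in> tree_chains \<Longrightarrow> (\<Sum>t\<in>F. \<bar>coord x t\<bar>) \<le> c"
  shows "norm x \<le> c"
  unfolding norm_tree_space_le_iff[OF assms(1)]
proof (rule chain_norm_le)
  fix F :: "node set" assume "finite F" "F \<in> tree_chains"
  then show "(\<Sum>t\<in>F. ennreal \<bar>coord x t\<bar>) \<le> ennreal c"
    using assms(2) by (simp add: sum_ennreal ennreal_leI)
qed

lemma norm_tree_space_mono:
  assumes "\<And>t. \<bar>coord x t\<bar> \<le> \<bar>coord y t\<bar>"
  shows "norm x \<le> norm y"
proof (rule norm_tree_space_leI)
  fix F assume F: "finite F" "F \<in> tree_chains"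
  have "(\<Sum>t\<in>F. \<bar>coord x t\<bar>) \<le> (\<Sum>t\<in>F. \<bar>coord y t\<bar>)"
    by (intro sum_mono assms)
  also have "\<dots> \<le> norm y" by (rule sum_abs_coord_le_norm[OF F])
  finally show "(\<Sum>t\<in>F. \<bar>coord x t\<bar>) \<le> norm y" .
qed simp

lemma bounded_linear_coord: "bounded_linear (\<lambda>x. coord x t)"
  by (rule bounded_linear_intro[where K = 1]) (simp_all add: abs_coord_le_norm)

definition truncation :: "node set \<Rightarrow> tree_space \<Rightarrow> tree_space" where
  "truncation G x = (\<Sum>t\<in>G. coord x t *\<^sub>R tree_unit t)"

lemma coord_truncation:
  "finite G \<Longrightarrow> coord (truncation G x) s = (if s \<in> G then coord x s else 0)"
  by (simp add: truncation_def if_distrib cong: if_cong)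

text \<open>A truncation to a large set approximates at least as well as any given finitely supported
  vector, since off the set that vector vanishes and on the set the truncation is exact.\<close>

lemma truncation_approx:
  assumes "\<epsilon> > 0"
  obtains F where "finite F" "\<And>G. finite G \<Longrightarrow> F \<subseteq> G \<Longrightarrow> norm (x - truncation G x) < \<epsilon>"
proof -
  obtain u where u: "finite {t. coord u t \<noteq> 0}" "norm (x - u) < \<epsilon>"
    using finite_support_approx[OF assms, of x] by metis
  show ?thesis
  proof (rule that[OF u(1)])
    fix G assume G: "finite G" "{t. coord u t \<noteq> 0} \<subseteq> G"
    have "norm (x - truncation G x) \<le> norm (x - u)"
    proof (rule norm_tree_space_mono)
      fix t
      have "coord u t = 0" if "t \<notin> G" using G(2) that by auto
      then show "\<bar>coord (x - truncation G x) t\<bar> \<le> \<bar>coord (x - u) t\<bar>"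
        using G(1) by (simp add: coord_truncation)
    qed
    then show "norm (x - truncation G x) < \<epsilon>" using u(2) by linarith
  qed
qed

lemma has_sum_coord: "((\<lambda>t. coord x t *\<^sub>R tree_unit t) has_sum x) UNIV"
  unfolding has_sum_def
proof (rule tendstoI)
  fix \<epsilon> :: real assume "\<epsilon> > 0"
  then obtain F where F: "finite F"
      "\<And>G. finite G \<Longrightarrow> F \<subseteq> G \<Longrightarrow> norm (x - truncation G x) < \<epsilon>"
    using truncation_approx[of \<epsilon> x] by metis
  then show "\<forall>\<^sub>F G in finite_subsets_at_top UNIV.
      dist (\<Sum>t\<in>G. coord x t *\<^sub>R tree_unit t) x < \<epsilon>"
    unfolding eventually_finite_subsets_at_top dist_norm truncation_def[symmetric]
    by (metis norm_minus_commute subset_UNIV)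
qed

lemma unconditional_basis_tree_unit: "unconditional_basis tree_unit"
  unfolding unconditional_basis_def
proof (intro allI ex1I)
  fix x :: tree_space
  show "((\<lambda>t. coord x t *\<^sub>R tree_unit t) has_sum x) UNIV" by (rule has_sum_coord)
  fix a assume a: "((\<lambda>t. a t *\<^sub>R tree_unit t) has_sum x) UNIV"
  show "a = coord x"
  proof
    fix s
    have "((\<lambda>t. coord (a t *\<^sub>R tree_unit t) s) has_sum coord x s) UNIV"
      using has_sum_bounded_linear[OF bounded_linear_coord a] by (simp add: o_def)
    moreover have "((\<lambda>t. coord (a t *\<^sub>R tree_unit t) s) has_sum a s) UNIV"
      by (rule has_sum_finite_neutralI[of "{s}"]) auto
    ultimately show "a s = coord x s" by (rule has_sum_unique[symmetric])
  qed
qed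

section \<open>Antichains far from a finite set\<close>

lemma norm_antichain_le:
  assumes "finite D" "\<And>s t. s \<in> D \<Longrightarrow> t \<in> D \<Longrightarrow> prefix s t \<Longrightarrow> s = t"
  shows "norm (\<Sum>t\<in>D. tree_unit t) \<le> 1"
proof (rule norm_tree_space_leI)
  fix F :: "node set" assume F: "finite F" "F \<in> tree_chains"
  have "(\<Sum>s\<in>F. \<bar>coord (\<Sum>t\<in>D. tree_unit t) s\<bar>) = (\<Sum>s\<in>F. if s \<in> D then 1 else 0)"
    using assms(1) by (intro sum.cong) auto
  also have "\<dots> = real (card (F \<inter> D))"
    using F(1) by (simp add: sum.If_cases)
  also have "card (F \<inter> D) \<le> Suc 0"
  proof -
    have "s = t" if "s \<in> F \<inter> D" "t \<in> F \<inter> D" for s t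
    proof -
      have "prefix s t \<or> prefix t s"
        using F(2) that by (auto simp: tree_chains_def chain_def)
      then show "s = t" using assms(2)[of s t] assms(2)[of t s] that by blast
    qed
    then show ?thesis using F(1) by (subst card_le_Suc0_iff_eq) auto
  qed
  finally show "(\<Sum>s\<in>F. \<bar>coord (\<Sum>t\<in>D. tree_unit t) s\<bar>) \<le> 1" by simp
qed simp

text \<open>The nodes that leave the all-\<open>True\<close> branch below \<open>s\<close> at different depths form an antichain.
  The sum of \<open>K\<close> of their unit vectors has norm at most 1, so a functional below \<open>-\<epsilon>\<close> at
  each of them would have norm at least \<open>K * \<epsilon>\<close>.\<close>

lemma deep_node_almost_nonneg:
  fixes f :: "tree_space \<Rightarrow> real"
  assumes f: "bounded_linear f" and "\<epsilon> > 0" and G: "finite G"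
  obtains t where "prefix s t" "\<And>u. prefix t u \<Longrightarrow> u \<notin> G" "f (tree_unit t) > - \<epsilon>"
proof -
  interpret f: bounded_linear f by (rule f)
  obtain N where N: "\<And>u. u \<in> G \<Longrightarrow> length u \<le> N"
    using G finite_imageI[OF G, of length] by (metis finite_nat_set_iff_bounded_le imageI)
  define node_at where "node_at k = s @ replicate (N + k) True @ [False]" for k
  have incomparable: "j = k" if "prefix (node_at j) (node_at k)" for j k
  proof -
    have "prefix (replicate (N + j) True @ [False]) (replicate (N + k) True @ [False])"
      using that by (simp add: node_at_def)
    then obtain zs where
      eq: "replicate (N + k) True @ [False] = replicate (N + j) True @ [False] @ zs"
      by (auto simp: prefix_def)
    have "j \<le> k" using arg_cong[OF eq, of length] by simp
    moreover have "\<not> j < k"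
    proof
      assume "j < k"
      then show False using arg_cong[OF eq, of "\<lambda>l. l ! (N + j)"] by (simp add: nth_append)
    qed
    ultimately show "j = k" by simp
  qed
  have inj: "inj_on node_at A" for A
    by (rule inj_onI) (auto intro: incomparable)
  obtain B where B: "B > 0" "\<And>x. norm (f x) \<le> norm x * B" using f.pos_bounded by blast
  obtain K :: nat where K: "B < real K * \<epsilon>"
    using reals_Archimedean3[OF \<open>\<epsilon> > 0\<close>] by blast
  have "\<exists>k<K. f (tree_unit (node_at k)) > - \<epsilon>"
  proof (rule ccontr)
    assume "\<not> ?thesis"
    then have neg: "f (tree_unit (node_at k)) \<le> - \<epsilon>" if "k < K" for k
      using that by force
    define v where "v = (\<Sum>t\<in>node_at ` {..<K}. tree_unit t)"
    have "norm v \<le> 1"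
      unfolding v_def by (rule norm_antichain_le) (auto dest: incomparable)
    then have "norm (f v) \<le> B"
      using B(2)[of v] mult_right_mono[of "norm v" 1 B] B(1) by linarith
    moreover have "f v = (\<Sum>k<K. f (tree_unit (node_at k)))"
      unfolding v_def f.sum by (simp add: sum.reindex[OF inj])
    moreover have "\<dots> \<le> (\<Sum>k<K. - \<epsilon>)" by (intro sum_mono neg) simp
    ultimately show False using K by simp
  qed
  then obtain k where k: "f (tree_unit (node_at k)) > - \<epsilon>" by blast
  show ?thesis
  proof (rule that[OF _ _ k])
    show "prefix s (node_at k)" by (simp add: node_at_def)
    fix u assume "prefix (node_at k) u"
    then have "N < length u" by (auto simp: node_at_def dest: prefix_length_le)
    then show "u \<notin> G" using N by force
  qed
qed

section \<open>Mass along a branch\<close>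

definition path_mass :: "node \<Rightarrow> tree_space \<Rightarrow> real" where
  "path_mass t x = (\<Sum>p\<in>set (prefixes t). coord x p)"

lemma path_mass_le_norm: "path_mass t x \<le> norm x"
proof -
  have "set (prefixes t) \<in> tree_chains"
    by (auto simp: tree_chains_def chain_def dest: prefix_same_cases)
  then have "(\<Sum>p\<in>set (prefixes t). \<bar>coord x p\<bar>) \<le> norm x"
    by (intro sum_abs_coord_le_norm) auto
  moreover have "path_mass t x \<le> (\<Sum>p\<in>set (prefixes t). \<bar>coord x p\<bar>)"
    unfolding path_mass_def by (intro sum_mono) auto
  ultimately show ?thesis by linarith
qed

lemma path_mass_mono:
  assumes "\<And>t. coord x t \<ge> 0" "prefix s t"
  shows "path_mass s x \<le> path_mass t x"
  unfolding path_mass_def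
  using assms by (intro sum_mono2) (auto intro: prefix_order.trans)

lemma path_mass_convex_combination:
  "path_mass t (a *\<^sub>R x + b *\<^sub>R y) = a * path_mass t x + b * path_mass t y"
  by (simp add: path_mass_def sum.distrib sum_distrib_left)

text \<open>A chain through \<open>t\<close> meets the support of \<open>y\<close> only in proper prefixes of \<open>t\<close>, so on such a
  chain the total mass after filling up at \<open>t\<close> is at most 1; other chains are not affected.\<close>

lemma fill_path:
  assumes y: "y \<in> tree_pos_ball" and below: "\<And>u. prefix t u \<Longrightarrow> coord y u = 0"
  defines "x \<equiv> y + (1 - path_mass t y) *\<^sub>R tree_unit t"
  shows "x \<in> tree_pos_ball" "path_mass t x = 1"
proof -
  have ny: "norm y \<le> 1" and nonneg: "coord y p \<ge> 0" for p
    using y by (auto simp: tree_pos_ball_def)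
  have mass: "path_mass t y \<le> 1" using path_mass_le_norm[of t y] ny by linarith
  have cx: "coord x p = coord y p + (if p = t then 1 - path_mass t y else 0)" for p
    by (simp add: x_def)
  have nonneg_x: "coord x p \<ge> 0" for p
    unfolding cx using nonneg[of p] mass by auto
  show "path_mass t x = 1"
    by (simp add: path_mass_def cx sum.distrib)
  have "norm x \<le> 1"
  proof (rule norm_tree_space_leI)
    fix F assume F: "finite F" "F \<in> tree_chains"
    have sum_F: "(\<Sum>p\<in>F. \<bar>coord x p\<bar>)
        = (\<Sum>p\<in>F. coord y p) + (if t \<in> F then 1 - path_mass t y else 0)"
      using F(1) nonneg_x by (simp add: cx sum.distrib)
    show "(\<Sum>p\<in>F. \<bar>coord x p\<bar>) \<le> 1"
    proof (cases "t \<in> F")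
      case True
      have "(\<Sum>p\<in>F. coord y p) = (\<Sum>p\<in>F \<inter> set (prefixes t). coord y p)"
      proof (intro sum.mono_neutral_right ballI)
        fix p assume p: "p \<in> F - F \<inter> set (prefixes t)"
        have "prefix p t \<or> prefix t p"
          using F(2) True p by (auto simp: tree_chains_def chain_def)
        then show "coord y p = 0" using p below by auto
      qed (use F(1) in auto)
      also have "\<dots> \<le> path_mass t y"
        unfolding path_mass_def using nonneg by (intro sum_mono2) auto
      finally show ?thesis using sum_F True by simp
    next
      case False
      have "(\<Sum>p\<in>F. coord y p) \<le> norm y"
        using sum_abs_coord_le_norm[OF F, of y] nonneg by simp
      then show ?thesis using sum_F False ny by simp
    qed
  qed simp
  then show "x \<in> tree_pos_ball" using nonneg_x by (simp add: tree_pos_ball_def)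
qed

lemma slice_meets_full_mass:
  fixes f :: "tree_space \<Rightarrow> real"
  assumes f: "bounded_linear f" and ne: "slice tree_pos_ball f \<delta> \<noteq> {}"
  obtains t x where "prefix s t" "x \<in> slice tree_pos_ball f \<delta>" "path_mass t x = 1"
proof -
  interpret f: bounded_linear f by (rule f)
  define c where "c = Sup (f ` tree_pos_ball) - \<delta>"
  obtain z where z: "z \<in> tree_pos_ball" "f z > c" using ne by (auto simp: slice_def c_def)
  \<comment> \<open>The gap is split evenly between the truncation and the filling up.\<close>
  define \<eta> where "\<eta> = (f z - c) / 2"
  have \<eta>: "\<eta> > 0" using z by (simp add: \<eta>_def)
  obtain B where B: "B > 0" "\<And>x. norm (f x) \<le> norm x * B" using f.pos_bounded by blast
  obtain G where G: "finite G" "norm (z - truncation G z) < \<eta> / B"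
    using truncation_approx[of "\<eta> / B" z] \<eta> B(1) by (metis divide_pos_pos order_refl)
  define y where "y = truncation G z"
  have cy: "coord y p = (if p \<in> G then coord z p else 0)" for p
    using G(1) by (simp add: y_def coord_truncation)
  have "norm y \<le> norm z" by (rule norm_tree_space_mono) (simp add: cy)
  then have y: "y \<in> tree_pos_ball" using z(1) by (auto simp: tree_pos_ball_def cy)
  have "norm (f (z - y)) < \<eta>"
    using B(2)[of "z - y"] G(2) B(1) by (simp add: y_def field_simps)
  then have fy: "f y > f z - \<eta>" by (simp add: f.diff)
  obtain t where t: "prefix s t" "\<And>u. prefix t u \<Longrightarrow> u \<notin> G" "f (tree_unit t) > - \<eta>"
    using deep_node_almost_nonneg[OF f \<eta> G(1), of s] by metis
  define m where "m = 1 - path_mass t y"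
  define x where "x = y + m *\<^sub>R tree_unit t"
  have x: "x \<in> tree_pos_ball" "path_mass t x = 1"
    using fill_path[OF y, of t] t(2) by (simp_all add: x_def m_def cy)
  have "0 \<le> path_mass t y"
    using y by (auto simp: path_mass_def tree_pos_ball_def intro: sum_nonneg)
  moreover have "path_mass t y \<le> 1"
    using path_mass_le_norm[of t y] y by (simp add: tree_pos_ball_def)
  ultimately have m: "0 \<le> m" "m \<le> 1" by (simp_all add: m_def)
  have "m * f (tree_unit t) \<ge> m * (- \<eta>)"
    using t(3) m(1) by (intro mult_left_mono) auto
  moreover have "m * \<eta> \<le> \<eta>" using m(2) \<eta> by simp
  ultimately have "f x > f z - \<eta> - \<eta>" using fy by (simp add: x_def f.add f.scaleR)
  then have "f x > c" by (simp add: \<eta>_def)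
  then have "x \<in> slice tree_pos_ball f \<delta>" using x(1) by (simp add: slice_def c_def)
  then show ?thesis using that t(1) x(2) by blast
qed

section \<open>Failure of slicely countable determination\<close>

lemma not_SCD_tree_pos_ball: "\<not> SCD_set tree_pos_ball"
proof
  assume "SCD_set tree_pos_ball"
  then obtain I :: "nat set" and S where
    slices: "\<And>i. i \<in> I \<Longrightarrow> \<exists>f \<delta>. bounded_linear f \<and> \<delta> > 0 \<and> S i = slice tree_pos_ball f \<delta>"
    and det: "determining tree_pos_ball I S"
    unfolding SCD_set_def by blast
  have S: "S i \<noteq> {}" "S i \<subseteq> tree_pos_ball" if "i \<in> I" for i
    using det that by (auto simp: determining_def)
  have "\<exists>t x. prefix s t \<and> (i \<in> I \<longrightarrow> x \<in> S i \<and> path_mass t x = 1)" for i s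
  proof (cases "i \<in> I")
    case True
    then obtain f \<delta> where "bounded_linear f" "S i = slice tree_pos_ball f \<delta>"
      using slices by blast
    then show ?thesis using S(1)[OF True] slice_meets_full_mass[of f \<delta> s] by metis
  qed auto
  then have "\<forall>i s. \<exists>t x. prefix s t \<and> (i \<in> I \<longrightarrow> x \<in> S i \<and> path_mass t x = 1)"
    by blast
  then obtain T X where TX: "\<And>i s. prefix s (T i s)"
      "\<And>i s. i \<in> I \<Longrightarrow> X i s \<in> S i \<and> path_mass (T i s) (X i s) = 1"
    by metis
  define s where "s = rec_nat [] T"
  have s_Suc: "s (Suc n) = T n (s n)" for n by (simp add: s_def)
  have s_mono: "prefix (s m) (s n)" if "m \<le> n" for m n
    using that
  proof (induction rule: dec_induct)
    case (step n)
    then show ?case using TX(1)[of "s n" n] s_Suc by (metis prefix_order.trans)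
  qed simp
  define x where "x i = X i (s i)" for i
  have x: "x i \<in> S i" "path_mass (s (Suc i)) (x i) = 1" if "i \<in> I" for i
    using TX(2)[OF that] by (simp_all add: x_def s_Suc)
  \<comment> \<open>Vectors whose mass on the branch through all \<open>s n\<close> is at least 1. Saying that the mass is
    reached at a finite stage avoids summing along the infinite branch.\<close>
  define C where "C = {z. \<exists>n. \<forall>m\<ge>n. 1 \<le> path_mass (s m) z}"
  have "convex C"
  proof (rule convexI)
    fix z w and a b :: real
    assume "z \<in> C" "w \<in> C" and ab: "0 \<le> a" "0 \<le> b" "a + b = 1"
    then obtain k l where kl: "\<And>m. m \<ge> k \<Longrightarrow> 1 \<le> path_mass (s m) z"
        "\<And>m. m \<ge> l \<Longrightarrow> 1 \<le> path_mass (s m) w"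
      by (auto simp: C_def)
    have "1 \<le> path_mass (s m) (a *\<^sub>R z + b *\<^sub>R w)" if "m \<ge> max k l" for m
    proof -
      have "a * 1 + b * 1 \<le> a * path_mass (s m) z + b * path_mass (s m) w"
        using that ab kl by (intro add_mono mult_left_mono) auto
      then show ?thesis using ab(3) by (simp add: path_mass_convex_combination)
    qed
    then show "a *\<^sub>R z + b *\<^sub>R w \<in> C" unfolding C_def by blast
  qed
  moreover have "x ` I \<subseteq> C"
  proof
    fix z assume "z \<in> x ` I"
    then obtain i where i: "i \<in> I" "z = x i" by blast
    have "coord (x i) p \<ge> 0" for p
      using x(1)[OF i(1)] S(2)[OF i(1)] by (auto simp: tree_pos_ball_def)
    then have "1 \<le> path_mass (s m) (x i)" if "m \<ge> Suc i" for m
      using path_mass_mono[OF _ s_mono[OF that], of "x i"] x(2)[OF i(1)] by simp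
    then show "z \<in> C" using i(2) by (auto simp: C_def)
  qed
  ultimately have "convex hull (x ` I) \<subseteq> C" by (rule hull_minimal[rotated])
  also have "C \<subseteq> {z. 1 \<le> norm z}"
    unfolding C_def using path_mass_le_norm by (auto intro: order_trans)
  finally have "closure (convex hull (x ` I)) \<subseteq> {z. 1 \<le> norm z}"
    by (rule closure_minimal) (intro closed_Collect_le continuous_intros)
  moreover have "tree_pos_ball \<subseteq> closure (convex hull (x ` I))"
    using det x(1) by (simp add: determining_def)
  moreover have "0 \<in> tree_pos_ball" by (simp add: tree_pos_ball_def)
  ultimately show False by force
qed

theorem theorem1p3:
  shows "\<not> SCD_set tree_pos_ball \<and>
         unconditional_basis tree_unit \<and>
         \<not> SCD_space TYPE(tree_space)"
  using not_SCD_tree_pos_ball unconditional_basis_tree_unit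
    bounded_tree_pos_ball tree_pos_ball_nonempty
  by (auto simp: SCD_space_def)

end
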